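(* If $d\ge 2$ is an integer, then $K_d\subset\overline{\langle K_2,H_1\rangle}$ and $H_d\subset\overline{\langle H_2,K_1\rangle}$.
   Context: $\mathcal{G}$ is the group of polynomial automorphisms of the affine plane $\mathbb{C}^2$, written as pairs $(F_1,F_2)\in\mathbb{C}[X,Y]^2$, with group law the composition of maps. For an integer $m\ge 1$, $H_m=\{(X,Y+aX^m)\mid a\in\mathbb{C}\}$ and $K_m=\{(X+aY^m,Y)\mid a\in\mathbb{C}\}$, subgroups of $\mathcal{G}$; $\langle\cdots\rangle$ denotes the subgroup generated. $\mathcal{G}$ is an ind-variety: $\mathcal{G}=\bigcup_n\mathcal{G}_{\le n}$, where $\mathcal{G}_{\le n}$ is the set of automorphisms of degree (maximum of the degrees of the two components) at most $n$, a locally closed subset of the finite-dimensional space of pairs of polynomials of degree at most $n$. A subset of $\mathcal{G}$ is closed iff its intersection with every $\mathcal{G}_{\le n}$ is Zariski closed in $\mathcal{G}_{\le n}$. $\overline{A}$ denotes the closure of $A\subset\mathcal{G}$ in this topology. *)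

theory Defs
  imports Complex_Main
    "HOL-Computational_Algebra.Polynomial"
    "HOL-Algebra.Generated_Groups"
    "HOL-Analysis.Abstract_Topology"
begin

section \<open>Bivariate polynomials\<close>

text \<open>
  \<open>\<complex>[X,Y]\<close> is rendered as \<open>\<complex>[X][Y]\<close>: the inner variable is \<open>X\<close>, the outer one is \<open>Y\<close>, and
  the coefficient of \<open>X\<^sup>i Y\<^sup>j\<close> in \<open>P\<close> is \<open>coeff (coeff P j) i\<close>.
\<close>

type_synonym bipoly = "complex poly poly"

definition Const :: "complex \<Rightarrow> bipoly" where "Const a = [:[:a:]:]"
definition varX :: bipoly where "varX = [:[:0, 1:]:]"
definition varY :: bipoly where "varY = [:0, 1:]"

definition coeff2 :: "bipoly \<Rightarrow> nat \<Rightarrow> nat \<Rightarrow> complex" where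
  "coeff2 P i j = coeff (coeff P j) i"

definition total_degree :: "bipoly \<Rightarrow> nat" where
  "total_degree P = Max (insert 0 {i + j | i j. coeff2 P i j \<noteq> 0})"

definition subst2 :: "bipoly \<Rightarrow> bipoly \<Rightarrow> bipoly \<Rightarrow> bipoly" where
  "subst2 P A B = poly (map_poly (\<lambda>c. poly (map_poly Const c) A) P) B"

definition eval2 :: "bipoly \<Rightarrow> complex \<Rightarrow> complex \<Rightarrow> complex" where
  "eval2 P x y = poly (poly P [:y:]) x"

lemma finite_total_degree_set: "finite {i + j | i j. coeff2 P i j \<noteq> 0}"
proof -
  have "{(i, j). coeff2 P i j \<noteq> 0} \<subseteq> (\<Union>j\<in>{..degree P}. {..degree (coeff P j)} \<times> {j})"
    by (auto simp: coeff2_def intro!: le_degree)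
  then have "finite {(i, j). coeff2 P i j \<noteq> 0}"
    by (rule finite_subset) auto
  then have "finite ((\<lambda>(i, j). i + j) ` {(i, j). coeff2 P i j \<noteq> 0})"
    by (rule finite_imageI)
  moreover have "(\<lambda>(i, j). i + j) ` {(i, j). coeff2 P i j \<noteq> 0} = {i + j | i j. coeff2 P i j \<noteq> 0}"
    by auto
  ultimately show ?thesis by simp
qed

lemma total_degree_le_iff:
  "total_degree P \<le> n \<longleftrightarrow> (\<forall>i j. coeff2 P i j \<noteq> 0 \<longrightarrow> i + j \<le> n)"
  unfolding total_degree_def using finite_total_degree_set[of P] by (subst Max_le_iff) auto

lemma eval2_simps [simp]:
  "eval2 0 x y = 0" "eval2 1 x y = 1" "eval2 varX x y = x" "eval2 varY x y = y"
  "eval2 (Const a) x y = a"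
  "eval2 (P + Q) x y = eval2 P x y + eval2 Q x y"
  "eval2 (P - Q) x y = eval2 P x y - eval2 Q x y"
  "eval2 (P * Q) x y = eval2 P x y * eval2 Q x y"
  "eval2 (P ^ n) x y = eval2 P x y ^ n"
  by (simp_all add: eval2_def varX_def varY_def Const_def)

lemma eval2_eqI:
  assumes "\<And>x y. eval2 P x y = eval2 Q x y"
  shows "P = Q"
proof -
  have zero: "R = 0" if R: "\<And>x y. eval2 R x y = 0" for R
  proof (rule ccontr)
    assume "R \<noteq> 0"
    have "poly R [:y:] = 0" for y
      using R[of _ y] poly_all_0_iff_0[of "poly R [:y:]"] by (simp add: eval2_def)
    then have "range (\<lambda>y. [:y:]) \<subseteq> {z. poly R z = 0}" by auto
    moreover have "infinite (range (\<lambda>y::complex. [:y:]))"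
      by (subst finite_image_iff) (auto simp: inj_on_def infinite_UNIV_char_0)
    ultimately show False
      using poly_roots_finite[OF \<open>R \<noteq> 0\<close>] finite_subset by blast
  qed
  have "P - Q = 0" by (rule zero) (simp add: assms)
  then show ?thesis by simp
qed

lemma eval2_subst2 [simp]:
  "eval2 (subst2 P A B) x y = eval2 P (eval2 A x y) (eval2 B x y)"
proof -
  have inner: "eval2 (poly (map_poly Const c) A) x y = poly c (eval2 A x y)" for c
  proof (induction c)
    case (pCons a c)
    then show ?case by (simp add: map_poly_pCons Const_def[of 0])
  qed simp
  have "eval2 (poly (map_poly (\<lambda>c. poly (map_poly Const c) A) P) B) x y
    = poly (poly P [:eval2 B x y:]) (eval2 A x y)"
  proof (induction P)
    case (pCons c P)
    then show ?case using inner by (simp add: map_poly_pCons)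
  qed simp
  then show ?thesis by (simp add: subst2_def eval2_def[of P])
qed


section \<open>The group of polynomial automorphisms of the affine plane\<close>

type_synonym polymap = "bipoly \<times> bipoly"

definition comp_map :: "polymap \<Rightarrow> polymap \<Rightarrow> polymap" where
  "comp_map F G = (subst2 (fst F) (fst G) (snd G), subst2 (snd F) (fst G) (snd G))"

definition is_automorphism :: "polymap \<Rightarrow> bool" where
  "is_automorphism F \<longleftrightarrow> (\<exists>G. comp_map F G = (varX, varY) \<and> comp_map G F = (varX, varY))"

definition Aut :: "polymap monoid" where
  "Aut = \<lparr>carrier = {F. is_automorphism F}, mult = comp_map, one = (varX, varY)\<rparr>"

lemma comp_map_assoc: "comp_map (comp_map F G) H = comp_map F (comp_map G H)"
  by (auto simp: comp_map_def intro: eval2_eqI)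

lemma comp_map_id [simp]: "comp_map F (varX, varY) = F" "comp_map (varX, varY) F = F"
  by (auto simp: comp_map_def prod_eq_iff intro: eval2_eqI)

lemma group_Aut: "group Aut"
proof (rule groupI)
  fix F G assume "F \<in> carrier Aut" "G \<in> carrier Aut"
  then obtain F' G' where
    "comp_map F F' = (varX, varY)" "comp_map F' F = (varX, varY)"
    "comp_map G G' = (varX, varY)" "comp_map G' G = (varX, varY)"
    by (auto simp: Aut_def is_automorphism_def)
  then have "comp_map (comp_map F G) (comp_map G' F') = (varX, varY)"
    "comp_map (comp_map G' F') (comp_map F G) = (varX, varY)"
    by (metis comp_map_assoc comp_map_id)+
  then have "is_automorphism (comp_map F G)"
    unfolding is_automorphism_def by blast
  then show "F \<otimes>\<^bsub>Aut\<^esub> G \<in> carrier Aut"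
    by (simp add: Aut_def)
next
  show "\<one>\<^bsub>Aut\<^esub> \<in> carrier Aut"
    unfolding Aut_def is_automorphism_def by (auto simp del: split_paired_Ex intro!: exI[of _ "(varX, varY)"])
next
  fix F assume "F \<in> carrier Aut"
  then obtain G where "comp_map F G = (varX, varY)" "comp_map G F = (varX, varY)"
    by (auto simp: Aut_def is_automorphism_def)
  moreover from this have "is_automorphism G"
    unfolding is_automorphism_def by blast
  ultimately show "\<exists>G\<in>carrier Aut. G \<otimes>\<^bsub>Aut\<^esub> F = \<one>\<^bsub>Aut\<^esub>"
    by (intro bexI[of _ G]) (simp_all add: Aut_def)
qed (simp_all add: Aut_def comp_map_assoc)

definition Hgrp :: "nat \<Rightarrow> polymap set" where
  "Hgrp m = {(varX, varY + Const a * varX ^ m) | a. True}"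

definition Kgrp :: "nat \<Rightarrow> polymap set" where
  "Kgrp m = {(varX + Const a * varY ^ m, varY) | a. True}"

lemma subgroup_Hgrp: "subgroup (Hgrp m) Aut"
proof -
  interpret group Aut by (rule group_Aut)
  have add: "comp_map (varX, varY + Const a * varX ^ m) (varX, varY + Const b * varX ^ m)
      = (varX, varY + Const (a + b) * varX ^ m)" for a b
    by (auto simp: comp_map_def algebra_simps intro: eval2_eqI)
  have zero: "(varX, varY + Const 0 * varX ^ m) = (varX, varY)"
    by (simp add: Const_def)
  have inv: "comp_map (varX, varY + Const a * varX ^ m) (varX, varY + Const (- a) * varX ^ m) = (varX, varY)"
    "comp_map (varX, varY + Const (- a) * varX ^ m) (varX, varY + Const a * varX ^ m) = (varX, varY)" for a
    unfolding add using zero by simp_all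
  have sub: "Hgrp m \<subseteq> carrier Aut"
    using inv by (fastforce simp: Hgrp_def Aut_def is_automorphism_def)
  show ?thesis
  proof (rule subgroupI[OF sub])
    fix F assume F: "F \<in> Hgrp m"
    then obtain a where a: "F = (varX, varY + Const a * varX ^ m)" by (auto simp: Hgrp_def)
    have "(varX, varY + Const (- a) * varX ^ m) \<in> Hgrp m" by (auto simp: Hgrp_def)
    moreover from this have "inv\<^bsub>Aut\<^esub> F = (varX, varY + Const (- a) * varX ^ m)"
      using sub F inv by (intro inv_equality) (auto simp: Aut_def a)
    ultimately show "inv\<^bsub>Aut\<^esub> F \<in> Hgrp m" by simp
  qed (use add in \<open>auto simp: Hgrp_def Aut_def\<close>)
qed

lemma subgroup_Kgrp: "subgroup (Kgrp m) Aut"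
proof -
  interpret group Aut by (rule group_Aut)
  have add: "comp_map (varX + Const a * varY ^ m, varY) (varX + Const b * varY ^ m, varY)
      = (varX + Const (a + b) * varY ^ m, varY)" for a b
    by (auto simp: comp_map_def algebra_simps intro: eval2_eqI)
  have zero: "(varX + Const 0 * varY ^ m, varY) = (varX, varY)"
    by (simp add: Const_def)
  have inv: "comp_map (varX + Const a * varY ^ m, varY) (varX + Const (- a) * varY ^ m, varY) = (varX, varY)"
    "comp_map (varX + Const (- a) * varY ^ m, varY) (varX + Const a * varY ^ m, varY) = (varX, varY)" for a
    unfolding add using zero by simp_all
  have sub: "Kgrp m \<subseteq> carrier Aut"
    using inv by (fastforce simp: Kgrp_def Aut_def is_automorphism_def)
  show ?thesis
  proof (rule subgroupI[OF sub])
    fix F assume F: "F \<in> Kgrp m"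
    then obtain a where a: "F = (varX + Const a * varY ^ m, varY)" by (auto simp: Kgrp_def)
    have "(varX + Const (- a) * varY ^ m, varY) \<in> Kgrp m" by (auto simp: Kgrp_def)
    moreover from this have "inv\<^bsub>Aut\<^esub> F = (varX + Const (- a) * varY ^ m, varY)"
      using sub F inv by (intro inv_equality) (auto simp: Aut_def a)
    ultimately show "inv\<^bsub>Aut\<^esub> F \<in> Kgrp m" by simp
  qed (use add in \<open>auto simp: Kgrp_def Aut_def\<close>)
qed


section \<open>The ind-topology\<close>

definition deg_map :: "polymap \<Rightarrow> nat" where
  "deg_map F = max (total_degree (fst F)) (total_degree (snd F))"

definition polymaps_le :: "nat \<Rightarrow> polymap set" where
  "polymaps_le n = {F. deg_map F \<le> n}"

definition Aut_le :: "nat \<Rightarrow> polymap set" where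
  "Aut_le n = {F \<in> carrier Aut. deg_map F \<le> n}"

text \<open>
  The polynomial functions in the coefficients of the two components. Coordinates with
  \<open>i + j > n\<close> vanish on \<^term>\<open>polymaps_le n\<close>, so restricted to that space these are exactly
  its polynomial functions.
\<close>

inductive_set coord_polys :: "(polymap \<Rightarrow> complex) set" where
  const: "(\<lambda>_. c) \<in> coord_polys"
| coord_fst: "(\<lambda>F. coeff2 (fst F) i j) \<in> coord_polys"
| coord_snd: "(\<lambda>F. coeff2 (snd F) i j) \<in> coord_polys"
| add: "f \<in> coord_polys \<Longrightarrow> g \<in> coord_polys \<Longrightarrow> (\<lambda>F. f F + g F) \<in> coord_polys"
| mult: "f \<in> coord_polys \<Longrightarrow> g \<in> coord_polys \<Longrightarrow> (\<lambda>F. f F * g F) \<in> coord_polys"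

definition zero_locus :: "nat \<Rightarrow> (polymap \<Rightarrow> complex) set \<Rightarrow> polymap set" where
  "zero_locus n S = {F \<in> polymaps_le n. \<forall>f\<in>S. f F = 0}"

definition zariski :: "nat \<Rightarrow> polymap topology" where
  "zariski n = topology (\<lambda>U. \<exists>S \<subseteq> coord_polys. U = polymaps_le n - zero_locus n S)"

lemma in_zariski_open:
  "F \<in> polymaps_le n - zero_locus n S \<longleftrightarrow> F \<in> polymaps_le n \<and> (\<exists>f\<in>S. f F \<noteq> 0)"
  by (auto simp: zero_locus_def)

lemma istopology_zariski:
  "istopology (\<lambda>U. \<exists>S \<subseteq> coord_polys. U = polymaps_le n - zero_locus n S)"
proof -
  define D where "D S = polymaps_le n - zero_locus n S" for S
  have D: "F \<in> D S \<longleftrightarrow> F \<in> polymaps_le n \<and> (\<exists>f\<in>S. f F \<noteq> 0)" for F S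
    unfolding D_def by (rule in_zariski_open)
  have Int: "\<exists>R \<subseteq> coord_polys. D S \<inter> D T = D R"
    if ST: "S \<subseteq> coord_polys" "T \<subseteq> coord_polys" for S T
  proof (intro exI conjI)
    let ?P = "(\<lambda>(f, g) F. f F * g F) ` (S \<times> T)"
    show "?P \<subseteq> coord_polys" using ST by (auto intro: coord_polys.mult)
    have "(\<exists>h\<in>?P. h F \<noteq> 0) \<longleftrightarrow> (\<exists>f\<in>S. f F \<noteq> 0) \<and> (\<exists>g\<in>T. g F \<noteq> 0)" for F
      by auto
    then show "D S \<inter> D T = D ?P"
      unfolding set_eq_iff Int_iff D by blast
  qed
  have Union: "\<exists>R \<subseteq> coord_polys. \<Union>\<U> = D R"
    if \<U>: "\<forall>U\<in>\<U>. \<exists>S \<subseteq> coord_polys. U = D S" for \<U>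
  proof (intro exI conjI)
    let ?R = "\<Union>{S. S \<subseteq> coord_polys \<and> D S \<in> \<U>}"
    show "?R \<subseteq> coord_polys" by blast
    show "\<Union>\<U> = D ?R"
    proof (intro equalityI subsetI)
      fix F assume "F \<in> \<Union>\<U>"
      then obtain U where U: "U \<in> \<U>" "F \<in> U" by blast
      with \<U> obtain S where S: "S \<subseteq> coord_polys" "U = D S" by meson
      have "S \<subseteq> ?R" using S U by blast
      moreover have "F \<in> D S" using S U by simp
      ultimately show "F \<in> D ?R" unfolding D by (meson subsetD)
    next
      fix F assume "F \<in> D ?R"
      then obtain S f where "F \<in> polymaps_le n" "D S \<in> \<U>" "f \<in> S" "f F \<noteq> 0"
        unfolding D by force
      then have "F \<in> D S" unfolding D by (intro conjI bexI)
      then show "F \<in> \<Union>\<U>" using \<open>D S \<in> \<U>\<close> by (rule UnionI[rotated])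
    qed
  qed
  show ?thesis
    unfolding istopology_def D_def[symmetric]
  proof (rule conjI; intro allI impI)
    fix U V assume "\<exists>S \<subseteq> coord_polys. U = D S" "\<exists>S \<subseteq> coord_polys. V = D S"
    then show "\<exists>S \<subseteq> coord_polys. U \<inter> V = D S" by (elim exE conjE) (simp add: Int)
  qed (rule Union)
qed

lemma openin_zariski:
  "openin (zariski n) U \<longleftrightarrow> (\<exists>S \<subseteq> coord_polys. U = polymaps_le n - zero_locus n S)"
  by (simp add: zariski_def topology_inverse'[OF istopology_zariski])

lemma topspace_zariski: "topspace (zariski n) = polymaps_le n"
proof
  show "topspace (zariski n) \<subseteq> polymaps_le n"
    by (auto simp: topspace_def openin_zariski)
  have "openin (zariski n) (polymaps_le n)"
    unfolding openin_zariski
    by (intro exI[of _ "{\<lambda>_. 1}"]) (auto simp: zero_locus_def coord_polys.const)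
  then show "polymaps_le n \<subseteq> topspace (zariski n)" by (rule openin_subset)
qed

lemma closedin_zariski:
  "closedin (zariski n) C \<longleftrightarrow> (\<exists>S \<subseteq> coord_polys. C = zero_locus n S)"
proof -
  have "zero_locus n S \<subseteq> polymaps_le n" for S by (auto simp: zero_locus_def)
  then show ?thesis
    unfolding closedin_def topspace_zariski openin_zariski by (metis Diff_Diff_Int Diff_subset inf.absorb_iff2)
qed

definition ind_topology :: "polymap topology" where
  "ind_topology = topology (\<lambda>U. U \<subseteq> carrier Aut \<and>
     (\<forall>n. openin (subtopology (zariski n) (Aut_le n)) (U \<inter> Aut_le n)))"

lemma istopology_ind:
  "istopology (\<lambda>U. U \<subseteq> carrier Aut \<and>
     (\<forall>n. openin (subtopology (zariski n) (Aut_le n)) (U \<inter> Aut_le n)))"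
proof -
  have Int: "openin (subtopology (zariski n) (Aut_le n)) (U \<inter> V \<inter> Aut_le n)"
    if "openin (subtopology (zariski n) (Aut_le n)) (U \<inter> Aut_le n)"
      "openin (subtopology (zariski n) (Aut_le n)) (V \<inter> Aut_le n)" for U V n
  proof -
    have "(U \<inter> Aut_le n) \<inter> (V \<inter> Aut_le n) = U \<inter> V \<inter> Aut_le n" by blast
    then show ?thesis using openin_Int[OF that] by simp
  qed
  have Union: "openin (subtopology (zariski n) (Aut_le n)) (\<Union>\<U> \<inter> Aut_le n)"
    if "\<And>U. U \<in> \<U> \<Longrightarrow> openin (subtopology (zariski n) (Aut_le n)) (U \<inter> Aut_le n)" for \<U> n
  proof -
    have "\<Union>\<U> \<inter> Aut_le n = (\<Union>U\<in>\<U>. U \<inter> Aut_le n)" by blast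
    moreover have "openin (subtopology (zariski n) (Aut_le n)) (\<Union>U\<in>\<U>. U \<inter> Aut_le n)"
      by (rule openin_Union) (use that in auto)
    ultimately show ?thesis by simp
  qed
  show ?thesis
    unfolding istopology_def
  proof (rule conjI; intro allI impI conjI)
    fix \<U> n
    assume *: "\<forall>U\<in>\<U>. U \<subseteq> carrier Aut \<and>
      (\<forall>n. openin (subtopology (zariski n) (Aut_le n)) (U \<inter> Aut_le n))"
    show "\<Union>\<U> \<subseteq> carrier Aut" using * by (meson Sup_least)
    show "openin (subtopology (zariski n) (Aut_le n)) (\<Union>\<U> \<inter> Aut_le n)"
      by (rule Union) (simp add: *)
  qed (simp_all add: Int le_infI1)
qed

lemma openin_ind_topology:
  "openin ind_topology U \<longleftrightarrow> U \<subseteq> carrier Aut \<and>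
     (\<forall>n. openin (subtopology (zariski n) (Aut_le n)) (U \<inter> Aut_le n))"
  by (simp add: ind_topology_def topology_inverse'[OF istopology_ind])

lemma topspace_Aut_le: "topspace (subtopology (zariski n) (Aut_le n)) = Aut_le n"
  by (auto simp: topspace_zariski polymaps_le_def Aut_le_def)

lemma topspace_ind_topology: "topspace ind_topology = carrier Aut"
proof
  show "topspace ind_topology \<subseteq> carrier Aut"
    by (auto simp: topspace_def openin_ind_topology)
  have "carrier Aut \<inter> Aut_le n = Aut_le n" for n by (auto simp: Aut_le_def)
  then have "openin ind_topology (carrier Aut)"
    unfolding openin_ind_topology by (metis topspace_Aut_le openin_topspace order_refl)
  then show "carrier Aut \<subseteq> topspace ind_topology" by (rule openin_subset)
qed

lemma closedin_ind_topology:
  "closedin ind_topology C \<longleftrightarrow> C \<subseteq> carrier Aut \<and>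
     (\<forall>n. closedin (subtopology (zariski n) (Aut_le n)) (C \<inter> Aut_le n))"
proof -
  have "(carrier Aut - C) \<inter> Aut_le n = Aut_le n - C \<inter> Aut_le n" for n
    by (auto simp: Aut_le_def)
  moreover have "C \<inter> Aut_le n \<subseteq> Aut_le n" for n by blast
  ultimately show ?thesis
    unfolding closedin_def topspace_Aut_le topspace_ind_topology openin_ind_topology by simp
qed

end

theory Submission imports Defs begin

text \<open>
  Let \<open>C\<close> be the closure of \<open>\<langle>K\<^sub>2, H\<^sub>1\<rangle>\<close>. Translations are continuous, so \<open>C\<close> is closed under
  composition. If \<open>K\<^sub>d \<subseteq> C\<close>, consider for \<open>s \<noteq> 0\<close> the commutator of \<open>(X + (c/s) Y\<^sup>d, Y)\<close> with the
  conjugate of \<open>(X + (1/s) Y\<^sup>2, Y)\<close> by the shear \<open>(X, Y + s\<^sup>2 X)\<close>. Its coefficients are polynomials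
  in \<open>s\<close> and its value at \<open>s = 0\<close> is \<open>(X - (d + 2) c Y\<^bsup>d+1\<^esup>, Y)\<close>, which therefore lies in \<open>C\<close>.
  In terms of Hamiltonians, this is the bracket of \<open>Y\<^bsup>d+1\<^esup>\<close> with the term \<open>X Y\<^sup>2\<close> of
  \<open>(Y + s\<^sup>2 X)\<^sup>3\<close>. The second inclusion follows by conjugating with \<open>(Y, X)\<close>.
\<close>

section \<open>Coefficients and degrees\<close>

lemma coeff2_add [simp]: "coeff2 (A + B) i j = coeff2 A i j + coeff2 B i j"
  by (simp add: coeff2_def)

lemma coeff2_Const: "coeff2 (Const a) i j = (if i = 0 \<and> j = 0 then a else 0)"
  by (auto simp: coeff2_def Const_def coeff_pCons split: nat.split)

lemma coeff2_mult:
  "coeff2 (A * B) i j = (\<Sum>l\<le>j. \<Sum>k\<le>i. coeff2 A k l * coeff2 B (i - k) (j - l))"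
  by (simp add: coeff2_def coeff_mult coeff_sum)

lemma total_degree_Const [simp]: "total_degree (Const a) = 0"
  using total_degree_le_iff[of "Const a" 0] by (auto simp: coeff2_Const)

lemma total_degree_add_le:
  "total_degree A \<le> n \<Longrightarrow> total_degree B \<le> m \<Longrightarrow> total_degree (A + B) \<le> max n m"
  unfolding total_degree_le_iff by (auto simp: le_max_iff_disj) (metis add_0)

lemma total_degree_mult_le:
  assumes "total_degree A \<le> n" "total_degree B \<le> m"
  shows "total_degree (A * B) \<le> n + m"
  unfolding total_degree_le_iff
proof (intro allI impI)
  fix i j assume "coeff2 (A * B) i j \<noteq> 0"
  then obtain l where l: "l \<le> j" "(\<Sum>k\<le>i. coeff2 A k l * coeff2 B (i - k) (j - l)) \<noteq> 0"
    unfolding coeff2_mult by (meson atMost_iff sum.not_neutral_contains_not_neutral)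
  then obtain k where k: "k \<le> i" "coeff2 A k l * coeff2 B (i - k) (j - l) \<noteq> 0"
    by (meson atMost_iff sum.not_neutral_contains_not_neutral)
  then have "k + l \<le> n" "(i - k) + (j - l) \<le> m"
    using assms mult_eq_0_iff unfolding total_degree_le_iff by metis+
  then show "i + j \<le> n + m" using k l by linarith
qed

lemma eval2_eq_sum:
  assumes "total_degree P \<le> n"
  shows "eval2 P x y = (\<Sum>j\<le>n. \<Sum>i\<le>n. coeff2 P i j * x ^ i * y ^ j)"
proof -
  have "coeff (coeff P j) i = 0" if "i > n \<or> j > n" for i j
    using assms that unfolding total_degree_le_iff coeff2_def by fastforce
  then have deg: "degree P \<le> n" "degree (coeff P j) \<le> n" for j
    by (auto intro!: degree_le simp: poly_eq_iff)
  have expand: "poly p z = (\<Sum>i\<le>n. coeff p i * z ^ i)"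
    if "degree p \<le> n" for p :: "'a::comm_ring_1 poly" and z
    by (subst poly_as_sum_of_monoms'[OF that, symmetric]) (simp add: poly_sum poly_monom)
  show ?thesis
    unfolding eval2_def expand[OF deg(1)] poly_sum poly_mult poly_power expand[OF deg(2)]
    by (simp add: coeff2_def sum_distrib_right)
qed

lemma eval2_sum [simp]: "eval2 (\<Sum>i\<in>I. f i) x y = (\<Sum>i\<in>I. eval2 (f i) x y)"
  by (induction I rule: infinite_finite_induct) simp_all

text \<open>The range of summation depends only on the bound \<open>n\<close>. One formula therefore
  serves a whole family of polynomials of bounded degree, and substitution is reduced to sums,
  products and powers.\<close>

lemma subst2_eq_sum:
  assumes "total_degree P \<le> n"
  shows "subst2 P A B = (\<Sum>j\<le>n. \<Sum>i\<le>n. Const (coeff2 P i j) * A ^ i * B ^ j)"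
  by (rule eval2_eqI) (simp add: eval2_eq_sum[OF assms])


section \<open>Regular families of polynomials\<close>

text \<open>The algebra \<open>R\<close> is a parameter because two cases occur: coordinate
  polynomials on \<open>Aut_le n\<close>, giving morphisms, and polynomials in one variable, giving
  curves. The uniform degree bound keeps the values in one finite-dimensional space.\<close>

definition regular_family :: "('a \<Rightarrow> complex) set \<Rightarrow> 'a set \<Rightarrow> ('a \<Rightarrow> bipoly) \<Rightarrow> bool" where
  "regular_family R D \<Phi> \<longleftrightarrow> (\<exists>n. \<forall>a\<in>D. total_degree (\<Phi> a) \<le> n) \<and>
     (\<forall>i j. \<exists>f\<in>R. \<forall>a\<in>D. coeff2 (\<Phi> a) i j = f a)"

definition regular_map :: "('a \<Rightarrow> complex) set \<Rightarrow> 'a set \<Rightarrow> ('a \<Rightarrow> polymap) \<Rightarrow> bool" where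
  "regular_map R D \<Phi> \<longleftrightarrow>
     regular_family R D (\<lambda>a. fst (\<Phi> a)) \<and> regular_family R D (\<lambda>a. snd (\<Phi> a))"

locale function_algebra =
  fixes R :: "('a \<Rightarrow> complex) set"
  assumes const: "(\<lambda>_. c) \<in> R"
    and add: "f \<in> R \<Longrightarrow> g \<in> R \<Longrightarrow> (\<lambda>a. f a + g a) \<in> R"
    and mult: "f \<in> R \<Longrightarrow> g \<in> R \<Longrightarrow> (\<lambda>a. f a * g a) \<in> R"
begin

lemma sum:
  assumes "\<And>i. i \<in> I \<Longrightarrow> f i \<in> R"
  shows "(\<lambda>a. \<Sum>i\<in>I. f i a) \<in> R"
  using assms by (induction I rule: infinite_finite_induct) (auto intro: const add)

lemma regular_scalar:
  assumes "f \<in> R" "\<And>a. a \<in> D \<Longrightarrow> g a = f a"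
  shows "regular_family R D (\<lambda>a. Const (g a))"
  unfolding regular_family_def
proof (intro conjI allI)
  show "\<exists>h\<in>R. \<forall>a\<in>D. coeff2 (Const (g a)) i j = h a" for i j
    using assms const[of 0] by (cases "i = 0 \<and> j = 0") (auto simp: coeff2_Const)
qed auto

lemma regular_const: "regular_family R D (\<lambda>_. P)"
  unfolding regular_family_def
proof (intro conjI allI)
  show "\<exists>h\<in>R. \<forall>a\<in>D. coeff2 P i j = h a" for i j
    by (rule bexI[OF _ const]) auto
qed auto

lemma regular_add:
  assumes "regular_family R D \<Phi>" "regular_family R D \<Psi>"
  shows "regular_family R D (\<lambda>a. \<Phi> a + \<Psi> a)"
  unfolding regular_family_def
proof (intro conjI allI)
  show "\<exists>n. \<forall>a\<in>D. total_degree (\<Phi> a + \<Psi> a) \<le> n"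
    using assms unfolding regular_family_def by (meson total_degree_add_le)
  fix i j
  obtain f g where "f \<in> R" "\<forall>a\<in>D. coeff2 (\<Phi> a) i j = f a"
    "g \<in> R" "\<forall>a\<in>D. coeff2 (\<Psi> a) i j = g a"
    using assms unfolding regular_family_def by meson
  then show "\<exists>h\<in>R. \<forall>a\<in>D. coeff2 (\<Phi> a + \<Psi> a) i j = h a"
    by (intro bexI[OF _ add[of f g]]) auto
qed

lemma regular_mult:
  assumes "regular_family R D \<Phi>" "regular_family R D \<Psi>"
  shows "regular_family R D (\<lambda>a. \<Phi> a * \<Psi> a)"
  unfolding regular_family_def
proof (intro conjI allI)
  show "\<exists>n. \<forall>a\<in>D. total_degree (\<Phi> a * \<Psi> a) \<le> n"
    using assms unfolding regular_family_def by (meson total_degree_mult_le)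
  fix i j
  have "\<forall>k l. \<exists>f\<in>R. \<forall>a\<in>D. coeff2 (\<Phi> a) k l = f a"
    "\<forall>k l. \<exists>f\<in>R. \<forall>a\<in>D. coeff2 (\<Psi> a) k l = f a"
    using assms unfolding regular_family_def by blast+
  then obtain f g where fg: "\<And>k l. f k l \<in> R" "\<And>k l a. a \<in> D \<Longrightarrow> coeff2 (\<Phi> a) k l = f k l a"
    "\<And>k l. g k l \<in> R" "\<And>k l a. a \<in> D \<Longrightarrow> coeff2 (\<Psi> a) k l = g k l a"
    by metis
  have "(\<lambda>a. \<Sum>l\<le>j. \<Sum>k\<le>i. f k l a * g (i - k) (j - l) a) \<in> R"
    by (intro sum mult fg)
  then show "\<exists>h\<in>R. \<forall>a\<in>D. coeff2 (\<Phi> a * \<Psi> a) i j = h a"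
    by (rule bexI[rotated]) (simp add: coeff2_mult fg)
qed

lemma regular_diff:
  assumes "regular_family R D \<Phi>" "regular_family R D \<Psi>"
  shows "regular_family R D (\<lambda>a. \<Phi> a - \<Psi> a)"
proof -
  have "\<Phi> a - \<Psi> a = \<Phi> a + Const (-1) * \<Psi> a" for a
    by (rule eval2_eqI) simp
  then show ?thesis
    by (simp only: regular_add regular_mult regular_const assms)
qed

lemma regular_power:
  assumes "regular_family R D \<Phi>"
  shows "regular_family R D (\<lambda>a. \<Phi> a ^ n)"
  by (induction n) (auto intro: regular_const regular_mult assms)

lemma regular_sum:
  assumes "\<And>i. i \<in> I \<Longrightarrow> regular_family R D (\<Phi> i)"
  shows "regular_family R D (\<lambda>a. \<Sum>i\<in>I. \<Phi> i a)"
  using assms by (induction I rule: infinite_finite_induct) (auto intro: regular_const regular_add)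

lemmas regular_intros = regular_const regular_add regular_mult regular_diff regular_power regular_sum

lemma regular_subst2:
  assumes "regular_family R D \<Phi>" "regular_family R D \<Psi>" "regular_family R D \<Psi>'"
  shows "regular_family R D (\<lambda>a. subst2 (\<Phi> a) (\<Psi> a) (\<Psi>' a))"
proof -
  obtain n where n: "\<And>a. a \<in> D \<Longrightarrow> total_degree (\<Phi> a) \<le> n"
    using assms(1) unfolding regular_family_def by blast
  have scalar: "regular_family R D (\<lambda>a. Const (coeff2 (\<Phi> a) i j))" for i j
  proof -
    obtain f where "f \<in> R" "\<forall>a\<in>D. coeff2 (\<Phi> a) i j = f a"
      using assms(1) unfolding regular_family_def by meson
    then show ?thesis by (intro regular_scalar) auto
  qed
  have "regular_family R D
      (\<lambda>a. \<Sum>j\<le>n. \<Sum>i\<le>n. Const (coeff2 (\<Phi> a) i j) * \<Psi> a ^ i * \<Psi>' a ^ j)"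
    by (intro regular_intros scalar assms)
  then show ?thesis
    unfolding regular_family_def by (simp add: subst2_eq_sum[OF n])
qed

lemma regular_comp_map:
  assumes "regular_map R D \<Phi>" "regular_map R D \<Psi>"
  shows "regular_map R D (\<lambda>a. comp_map (\<Phi> a) (\<Psi> a))"
  using assms by (auto simp: regular_map_def comp_map_def intro: regular_subst2)

lemma regular_map_const: "regular_map R D (\<lambda>_. F)"
  by (simp add: regular_map_def regular_const)

text \<open>Induction on \<open>f\<close>: coordinates pull back to coefficient functions, and
  \<open>R\<close> is stable under sums and products. Equations of a closed set thus become
  functions in \<open>R\<close>.\<close>

lemma regular_map_pullback:
  assumes \<Phi>: "regular_map R D \<Phi>" and "f \<in> coord_polys"
  shows "\<exists>g\<in>R. \<forall>a\<in>D. f (\<Phi> a) = g a"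
  using assms(2)
proof induction
  case (add f g)
  then obtain f' g' where "f' \<in> R" "g' \<in> R" "\<forall>a\<in>D. f (\<Phi> a) = f' a" "\<forall>a\<in>D. g (\<Phi> a) = g' a"
    by blast
  then show ?case by (intro bexI[OF _ function_algebra.add[OF function_algebra_axioms, of f' g']]) auto
next
  case (mult f g)
  then obtain f' g' where "f' \<in> R" "g' \<in> R" "\<forall>a\<in>D. f (\<Phi> a) = f' a" "\<forall>a\<in>D. g (\<Phi> a) = g' a"
    by blast
  then show ?case by (intro bexI[OF _ function_algebra.mult[OF function_algebra_axioms, of f' g']]) auto
qed (use \<Phi> const in \<open>auto simp: regular_map_def regular_family_def\<close>)

end

lemma regular_map_deg_bound:
  assumes "regular_map R D \<Phi>"
  shows "\<exists>m. \<forall>a\<in>D. deg_map (\<Phi> a) \<le> m"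
proof -
  obtain k l where "\<forall>a\<in>D. total_degree (fst (\<Phi> a)) \<le> k" "\<forall>a\<in>D. total_degree (snd (\<Phi> a)) \<le> l"
    using assms unfolding regular_map_def regular_family_def by blast
  then show ?thesis
    by (intro exI[of _ "max k l"]) (auto simp: deg_map_def intro: max.mono order_trans)
qed

section \<open>The two function algebras: coordinates and one parameter\<close>

interpretation coord_polys: function_algebra coord_polys
  by standard (auto intro: coord_polys.intros)

interpretation curves: function_algebra "range (poly :: complex poly \<Rightarrow> _)"
proof
  show "(\<lambda>_. c) \<in> range poly" for c :: complex
    by (rule image_eqI[of _ _ "[:c:]"]) auto
  fix f g :: "complex \<Rightarrow> complex" assume "f \<in> range poly" "g \<in> range poly"
  then obtain p q where "f = poly p" "g = poly q" by blast
  then show "(\<lambda>a. f a + g a) \<in> range poly" "(\<lambda>a. f a * g a) \<in> range poly"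
    by (intro range_eqI[of _ _ "p + q"] range_eqI[of _ _ "p * q"]; simp add: fun_eq_iff)+
qed

text \<open>Degrees are unbounded on the whole group, so the domain is a single filtration
  step.\<close>

lemma regular_map_id: "regular_map coord_polys (Aut_le n) (\<lambda>F. F)"
  unfolding regular_map_def regular_family_def
proof (intro conjI allI)
  show "\<exists>k. \<forall>F\<in>Aut_le n. total_degree (fst F) \<le> k" "\<exists>k. \<forall>F\<in>Aut_le n. total_degree (snd F) \<le> k"
    by (auto simp: Aut_le_def deg_map_def)
  show "\<exists>f\<in>coord_polys. \<forall>F\<in>Aut_le n. coeff2 (fst F) i j = f F" for i j
    by (rule bexI[OF _ coord_polys.coord_fst[of i j]]) simp
  show "\<exists>f\<in>coord_polys. \<forall>F\<in>Aut_le n. coeff2 (snd F) i j = f F" for i j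
    by (rule bexI[OF _ coord_polys.coord_snd[of i j]]) simp
qed


section \<open>Closed subsets of the automorphism group\<close>

lemma closedin_ind_topology_iff:
  "closedin ind_topology C \<longleftrightarrow> C \<subseteq> carrier Aut \<and>
     (\<forall>n. \<exists>S\<subseteq>coord_polys. \<forall>F\<in>Aut_le n. F \<in> C \<longleftrightarrow> (\<forall>f\<in>S. f F = 0))"
proof -
  have "closedin (subtopology (zariski n) (Aut_le n)) (C \<inter> Aut_le n) \<longleftrightarrow>
      (\<exists>S\<subseteq>coord_polys. \<forall>F\<in>Aut_le n. F \<in> C \<longleftrightarrow> (\<forall>f\<in>S. f F = 0))" for n
  proof -
    have zero_locus: "C \<inter> Aut_le n = zero_locus n S \<inter> Aut_le n \<longleftrightarrow>
        (\<forall>F\<in>Aut_le n. F \<in> C \<longleftrightarrow> (\<forall>f\<in>S. f F = 0))" for S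
      by (auto simp: zero_locus_def Aut_le_def polymaps_le_def)
    have "closedin (subtopology (zariski n) (Aut_le n)) (C \<inter> Aut_le n) \<longleftrightarrow>
        (\<exists>S\<subseteq>coord_polys. C \<inter> Aut_le n = zero_locus n S \<inter> Aut_le n)"
      unfolding closedin_subtopology closedin_zariski by metis
    then show ?thesis by (simp only: zero_locus)
  qed
  then show ?thesis by (simp add: closedin_ind_topology)
qed

text \<open>Morphisms are continuous: the degree bound sends \<open>Aut_le n\<close> into one
  \<open>Aut_le m\<close>, and the equations of \<open>C\<close> there pull back to equations on
  \<open>Aut_le n\<close>.\<close>

lemma closedin_vimage:
  assumes C: "closedin ind_topology C"
    and \<Phi>: "\<And>n. regular_map coord_polys (Aut_le n) \<Phi>" "\<And>F. F \<in> carrier Aut \<Longrightarrow> \<Phi> F \<in> carrier Aut"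
  shows "closedin ind_topology {F \<in> carrier Aut. \<Phi> F \<in> C}"
  unfolding closedin_ind_topology_iff
proof (intro conjI allI)
  fix n
  obtain m where "\<forall>F\<in>Aut_le n. deg_map (\<Phi> F) \<le> m"
    using regular_map_deg_bound[OF \<Phi>(1)] by blast
  then have m: "\<Phi> F \<in> Aut_le m" if "F \<in> Aut_le n" for F
    using that \<Phi>(2)[of F] by (auto simp: Aut_le_def simp del: split_paired_All)
  obtain S where S: "S \<subseteq> coord_polys" "\<And>F. F \<in> Aut_le m \<Longrightarrow> F \<in> C \<longleftrightarrow> (\<forall>f\<in>S. f F = 0)"
    using C unfolding closedin_ind_topology_iff by meson
  have "\<forall>f\<in>S. \<exists>g. g \<in> coord_polys \<and> (\<forall>F\<in>Aut_le n. f (\<Phi> F) = g F)"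
    using coord_polys.regular_map_pullback[OF \<Phi>(1) subsetD[OF S(1)]] by (simp add: Bex_def)
  then obtain g where g: "\<forall>f\<in>S. g f \<in> coord_polys \<and> (\<forall>F\<in>Aut_le n. f (\<Phi> F) = g f F)"
    by (rule bchoice[THEN exE])
  show "\<exists>S\<subseteq>coord_polys. \<forall>F\<in>Aut_le n. F \<in> {F \<in> carrier Aut. \<Phi> F \<in> C} \<longleftrightarrow> (\<forall>f\<in>S. f F = 0)"
    by (intro exI[of _ "g ` S"]) (use g S m in \<open>auto simp: Aut_le_def\<close>)
qed auto

text \<open>Along the curve each equation of \<open>C\<close> becomes a polynomial in
  \<open>s\<close> with infinitely many roots, hence zero. That the limit is an automorphism has to
  be assumed: (X, sY) degenerates at s = 0.\<close>

lemma closedin_curve_limit: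
  assumes C: "closedin ind_topology C"
    and \<Phi>: "regular_map (range poly) UNIV \<Phi>"
    and mem: "\<And>s. s \<noteq> 0 \<Longrightarrow> \<Phi> s \<in> C" and aut: "\<Phi> 0 \<in> carrier Aut"
  shows "\<Phi> 0 \<in> C"
proof -
  obtain m where m: "\<And>s. deg_map (\<Phi> s) \<le> m"
    using regular_map_deg_bound[OF \<Phi>] by blast
  obtain S where S: "S \<subseteq> coord_polys" "\<And>F. F \<in> Aut_le m \<Longrightarrow> F \<in> C \<longleftrightarrow> (\<forall>f\<in>S. f F = 0)"
    using C unfolding closedin_ind_topology_iff by meson
  have "C \<subseteq> carrier Aut" using C by (simp add: closedin_ind_topology_iff)
  then have le: "\<Phi> s \<in> Aut_le m" for s
    using m mem aut by (cases "s = 0") (auto simp: Aut_le_def)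
  have "f (\<Phi> 0) = 0" if f: "f \<in> S" for f
  proof -
    obtain p where p: "\<And>s. f (\<Phi> s) = poly p s"
      using curves.regular_map_pullback[OF \<Phi>, of f] f S(1) by auto
    have "poly p s = 0" if "s \<noteq> 0" for s
      using S(2)[OF le] mem that f p by metis
    then have "UNIV - {0} \<subseteq> {s. poly p s = 0}" by auto
    then have "infinite {s. poly p s = 0}"
      using infinite_UNIV_char_0 by (metis finite_Diff2 finite.emptyI finite_insert finite_subset)
    then have "p = 0" using poly_roots_finite by blast
    then show ?thesis by (simp add: p)
  qed
  then show ?thesis using S(2)[OF le] by blast
qed

section \<open>Translations and closures of subgroups\<close>

lemma comp_map_carrier:
  "F \<in> carrier Aut \<Longrightarrow> G \<in> carrier Aut \<Longrightarrow> comp_map F G \<in> carrier Aut"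
  using monoid.m_closed[OF group.is_monoid[OF group_Aut], of F G] by (simp add: Aut_def)

text \<open>The two-sided form covers left translation, right translation and conjugation by
  \<open>swap\<close>.\<close>

lemma closedin_translates:
  assumes "closedin ind_topology C" "G \<in> carrier Aut" "G' \<in> carrier Aut"
  shows "closedin ind_topology {F \<in> carrier Aut. comp_map (comp_map G F) G' \<in> C}"
  using assms
  by (intro closedin_vimage coord_polys.regular_comp_map coord_polys.regular_map_const
      regular_map_id comp_map_carrier)

text \<open>Continuity in each factor separately is enough. Left translation by an element of
  \<open>A\<close> preserves the closure; then, for fixed \<open>G\<close> in the closure, the set
  of \<open>F\<close> with \<open>comp_map F G\<close> in the closure is closed and contains
  \<open>A\<close>.\<close>

lemma comp_map_closure:
  assumes sub: "subgroup A Aut"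
    and F: "F \<in> ind_topology closure_of A" and G: "G \<in> ind_topology closure_of A"
  shows "comp_map F G \<in> ind_topology closure_of A"
proof -
  let ?C = "ind_topology closure_of A"
  have A: "A \<subseteq> carrier Aut" using subgroup.subset[OF sub] .
  have one: "(varX, varY) \<in> carrier Aut"
    using subgroup.one_closed[OF sub] A by (auto simp: Aut_def)
  have C: "closedin ind_topology ?C" by simp
  have incl: "A \<subseteq> ?C" using closure_of_subset[of A ind_topology] A by (simp add: topspace_ind_topology)
  have carr: "?C \<subseteq> carrier Aut"
    using closure_of_subset_topspace[of ind_topology A] by (simp add: topspace_ind_topology)
  have mult: "comp_map a b \<in> A" if "a \<in> A" "b \<in> A" for a b
    using subgroup.m_closed[OF sub that] by (simp add: Aut_def)
  have left: "comp_map a g \<in> ?C" if a: "a \<in> A" and g: "g \<in> ?C" for a g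
  proof -
    have "?C \<subseteq> {F \<in> carrier Aut. comp_map (comp_map a F) (varX, varY) \<in> ?C}"
      by (rule closure_of_minimal[OF _ closedin_translates[OF C subsetD[OF A a] one]])
        (use A incl mult[OF a] in auto)
    then show ?thesis using g by auto
  qed
  have "?C \<subseteq> {F \<in> carrier Aut. comp_map (comp_map (varX, varY) F) G \<in> ?C}"
    by (rule closure_of_minimal[OF _ closedin_translates[OF C one subsetD[OF carr G]]])
      (use A left[OF _ G] in auto)
  then show ?thesis using F by auto
qed


section \<open>Raising the degree\<close>

abbreviation shearK :: "nat \<Rightarrow> complex \<Rightarrow> polymap" where
  "shearK m a \<equiv> (varX + Const a * varY ^ m, varY)"

abbreviation shearH :: "nat \<Rightarrow> complex \<Rightarrow> polymap" where
  "shearH m a \<equiv> (varX, varY + Const a * varX ^ m)"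

lemma Kgrp_Suc_subset:
  assumes sub: "subgroup A Aut" and K2: "Kgrp 2 \<subseteq> A" and H1: "Hgrp 1 \<subseteq> A"
    and Kd: "Kgrp d \<subseteq> ind_topology closure_of A"
  shows "Kgrp (Suc d) \<subseteq> ind_topology closure_of A"
proof
  let ?C = "ind_topology closure_of A"
  have incl: "A \<subseteq> ?C"
    using closure_of_subset[of A ind_topology] subgroup.subset[OF sub]
    by (simp add: topspace_ind_topology)
  fix F assume F: "F \<in> Kgrp (Suc d)"
  then obtain a where a: "F = shearK (Suc d) a" by (auto simp: Kgrp_def)
  \<comment> \<open>Chosen so that the coefficient -(d + 2) c of the limit equals
    \<open>a\<close>.\<close>
  define c where "c = - a / of_nat (d + 2)"
  have c: "a = - of_nat (d + 2) * c" unfolding c_def using of_nat_neq_0[of "Suc d"] by (simp add: field_simps del: of_nat_add of_nat_Suc)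
  \<comment> \<open>This conjugate preserves the linear form Y + s^2 X, and \<open>g s (-b)\<close>
    is inverse to \<open>g s b\<close>. For b = 1/s it has a pole at s = 0 in its first component
    only.\<close>
  define g where "g s b = comp_map (shearH 1 (- (s\<^sup>2))) (comp_map (shearK 2 b) (shearH 1 (s\<^sup>2)))"
    for s b
  \<comment> \<open>\<open>z\<close> is the preserved form. \<open>y\<close> is the second
    coordinate after \<open>g s (-(1/s))\<close>, \<open>z'\<close> the value of the form after the
    next shear, and \<open>y'\<close> the final second coordinate.\<close>
  define z y z' y' where
    "z s = varY + Const (s\<^sup>2) * varX" and
    "y s = varY + Const s * z s ^ 2" and
    "z' s = z s - Const (c * s) * y s ^ d" and
    "y' s = varY + Const s * (Const (2 * c * s) * z s * y s ^ d - Const (c\<^sup>2 * s\<^sup>2) * (y s ^ d)\<^sup>2)"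
    for s
  note defs = z_def y_def z'_def y'_def
  \<comment> \<open>The commutator with its poles in \<open>s\<close> already cancelled, so that it
    also makes sense at s = 0.\<close>
  define \<Phi> where "\<Phi> s = (varX - Const (2 * c) * z s * y s ^ d + Const (c\<^sup>2 * s) * (y s ^ d)\<^sup>2
      - Const c * z' s ^ 2 * (\<Sum>i<d. y' s ^ i * y s ^ (d - Suc i)), y' s)" for s
  have \<Phi>: "\<Phi> s = comp_map (shearK d (c / s)) (comp_map (g s (1 / s))
      (comp_map (shearK d (- c / s)) (g s (- (1 / s)))))" (is "_ = ?R")
    if s: "s \<noteq> 0" for s
  proof -
    have "eval2 (fst (\<Phi> s)) u v = eval2 (fst ?R) u v \<and> eval2 (snd (\<Phi> s)) u v = eval2 (snd ?R) u v" for u v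
    proof -
      \<comment> \<open>A point (u, v) is followed through the maps, the rightmost first: (u -
        Z^2/s, y1), then (x2, y1), then (x2 + z2^2/s, y3). The last shear adds (c/s) y3^d to the
        first coordinate.\<close>
      define Z where "Z = v + s\<^sup>2 * u"
      define y1 where "y1 = v + s * Z\<^sup>2"
      define P where "P = y1 ^ d"
      define x2 where "x2 = u - Z\<^sup>2 / s - c / s * P"
      define z2 where "z2 = Z - c * s * P"
      define y3 where "y3 = v + s * (2 * c * s * Z * P - c\<^sup>2 * s\<^sup>2 * P\<^sup>2)"
      have g: "eval2 (fst (g s b)) x y = x + b * (y + s\<^sup>2 * x)\<^sup>2"
        "eval2 (snd (g s b)) x y = y - s\<^sup>2 * b * (y + s\<^sup>2 * x)\<^sup>2" for b x y
        by (simp_all add: g_def comp_map_def algebra_simps)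
      have y1: "v + s\<^sup>2 * (Z\<^sup>2 / s) = y1" and z2: "y1 + s\<^sup>2 * x2 = z2"
        using s by (simp_all add: y1_def z2_def x2_def Z_def field_simps power2_eq_square)
      have y3: "y3 = y1 - s * z2\<^sup>2"
        by (simp add: y3_def y1_def z2_def algebra_simps power2_eq_square)
      \<comment> \<open>The difference of d-th powers contains the factor y3 - y1 = -s z2^2, whose
        \<open>s\<close> cancels the pole of c/s.\<close>
      have y3_power: "y3 ^ d = P - s * z2\<^sup>2 * (\<Sum>i<d. y3 ^ i * y1 ^ (d - Suc i))"
        using power_diff_sumr2[of y3 d y1] by (simp add: P_def y3 algebra_simps)
      have top: "c / s * y3 ^ d = c / s * P - c * z2\<^sup>2 * (\<Sum>i<d. y3 ^ i * y1 ^ (d - Suc i))"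
        unfolding y3_power using s by (simp add: right_diff_distrib)
      \<comment> \<open>The remaining poles cancel: z2^2/s against Z^2/s up to regular terms, and
        the two terms (c/s) P against each other.\<close>
      have rest: "x2 + z2\<^sup>2 / s + c / s * P = u - 2 * c * Z * P + c\<^sup>2 * s * P\<^sup>2"
        using s by (simp add: x2_def z2_def field_simps power2_eq_square)
      have x4: "x2 + z2\<^sup>2 / s + c / s * y3 ^ d
          = u - 2 * c * Z * P + c\<^sup>2 * s * P\<^sup>2 - c * z2\<^sup>2 * (\<Sum>i<d. y3 ^ i * y1 ^ (d - Suc i))"
        by (simp only: top add_diff_eq rest)
      have \<Phi>_eval: "eval2 (fst (\<Phi> s)) u v = x2 + z2\<^sup>2 / s + c / s * y3 ^ d" "eval2 (snd (\<Phi> s)) u v = y3"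
        unfolding x4 by (simp_all add: \<Phi>_def defs Z_def y1_def P_def z2_def y3_def)
      have 1: "eval2 (fst (g s (- (1 / s)))) u v = u - Z\<^sup>2 / s" "eval2 (snd (g s (- (1 / s)))) u v = y1"
        by (simp_all add: g Z_def flip: y1)
      have 2: "eval2 (fst (g s (1 / s))) x2 y1 = x2 + z2\<^sup>2 / s" "eval2 (snd (g s (1 / s))) x2 y1 = y3"
        unfolding g z2 y3 using s by (simp_all add: power2_eq_square)
      have "eval2 (fst (comp_map (shearK d (- c / s)) (g s (- (1 / s))))) u v = x2"
        "eval2 (snd (comp_map (shearK d (- c / s)) (g s (- (1 / s))))) u v = y1"
        by (simp_all add: comp_map_def 1 x2_def P_def)
      with 2 show ?thesis
        unfolding \<Phi>_eval by (simp add: comp_map_def)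
    qed
    then show ?thesis by (intro prod_eqI eval2_eqI) blast+
  qed
  have mem: "\<Phi> s \<in> ?C" if "s \<noteq> 0" for s
  proof -
    have "shearK d b \<in> ?C" for b using Kd by (auto simp: Kgrp_def)
    moreover have "shearH 1 b \<in> ?C" "shearK 2 b \<in> ?C" for b
      using H1 K2 incl by (auto simp: Hgrp_def Kgrp_def)
    ultimately show ?thesis
      unfolding \<Phi>[OF that] g_def by (intro comp_map_closure[OF sub])
  qed
  have lim: "\<Phi> 0 = F"
  proof -
    have "eval2 (fst (\<Phi> 0)) u v = eval2 (fst F) u v" for u v
    proof -
      \<comment> \<open>At s = 0 all four auxiliary polynomials equal Y. The sum then has d equal
        terms and contributes -d c Y^(d+1), in addition to -2 c Y^(d+1).\<close>
      have "(\<Sum>i<d. v ^ i * v ^ (d - Suc i)) = (\<Sum>i<d. v ^ (d - 1))"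
        by (intro sum.cong) (auto simp flip: power_add)
      \<comment> \<open>For d = 0 the exponent d - 1 is truncated, but the factor d
        vanishes.\<close>
      moreover have "v\<^sup>2 * (of_nat d * v ^ (d - 1)) = of_nat d * v ^ Suc d"
        by (cases d) (simp_all add: power2_eq_square)
      ultimately show ?thesis
        by (auto simp: \<Phi>_def defs a c algebra_simps)
    qed
    moreover have "eval2 (snd (\<Phi> 0)) u v = eval2 (snd F) u v" for u v
      by (simp add: \<Phi>_def defs a)
    ultimately show ?thesis by (intro prod_eqI eval2_eqI)
  qed
  have "regular_map (range poly) UNIV \<Phi>"
  proof -
    \<comment> \<open>All coefficients of \<open>\<Phi>\<close> depending on \<open>s\<close> are
      monomials in \<open>s\<close>; the simplified instances match the forms in which they
      occur.\<close>
    have poly: "regular_family (range poly) UNIV (\<lambda>s. Const (b * s ^ n))" for b n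
      by (rule curves.regular_scalar[of "poly (monom b n)"]) (auto simp: poly_monom)
    note scalars = poly[of 1 1, simplified] poly[of 1 2, simplified] poly[of _ 1, simplified] poly
    show ?thesis
      unfolding regular_map_def \<Phi>_def defs fst_conv snd_conv
      by (intro conjI curves.regular_intros scalars)
  qed
  moreover have "\<Phi> 0 \<in> carrier Aut"
    unfolding lim using F subgroup.subset[OF subgroup_Kgrp] by blast
  ultimately have "\<Phi> 0 \<in> ?C"
    using closedin_curve_limit[of ?C \<Phi>] mem by simp
  then show "F \<in> ?C" by (simp add: lim)
qed

text \<open>Induction starting at d = 2, where \<open>Kgrp 2\<close> is among the
  generators.\<close>

lemma Kgrp_subset_closure:
  assumes "d \<ge> 2"
  shows "Kgrp d \<subseteq> ind_topology closure_of (generate Aut (Kgrp 2 \<union> Hgrp 1))"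
proof -
  let ?A = "generate Aut (Kgrp 2 \<union> Hgrp 1)"
  have sub: "subgroup ?A Aut"
    using subgroup.subset[OF subgroup_Kgrp] subgroup.subset[OF subgroup_Hgrp]
    by (intro group.generate_is_subgroup[OF group_Aut]) auto
  have gens: "Kgrp 2 \<subseteq> ?A" "Hgrp 1 \<subseteq> ?A" by (auto intro: generate.incl)
  have "?A \<subseteq> ind_topology closure_of ?A"
    using closure_of_subset[of ?A ind_topology] subgroup.subset[OF sub]
    by (simp add: topspace_ind_topology)
  with assms show ?thesis
    by (induction d rule: dec_induct) (use gens Kgrp_Suc_subset[OF sub gens] in auto)
qed


section \<open>Exchanging the variables\<close>

abbreviation swap :: polymap where "swap \<equiv> (varY, varX)"

text \<open>Conjugation by \<open>swap\<close>, which is its own inverse.\<close>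

definition conj_swap :: "polymap \<Rightarrow> polymap" where
  "conj_swap F = comp_map (comp_map swap F) swap"

lemma swap_swap: "comp_map swap swap = (varX, varY)"
  by (auto simp: comp_map_def intro: eval2_eqI)

lemma swap_carrier: "swap \<in> carrier Aut"
  using swap_swap by (auto simp: Aut_def is_automorphism_def)

lemma conj_swap_hom: "conj_swap \<in> hom Aut Aut"
proof (rule homI)
  show "conj_swap F \<in> carrier Aut" if "F \<in> carrier Aut" for F
    using that by (simp add: conj_swap_def comp_map_carrier swap_carrier)
  have "conj_swap (comp_map F G) = comp_map (conj_swap F) (conj_swap G)" for F G
    by (metis conj_swap_def comp_map_assoc comp_map_id(2) swap_swap)
  then show "conj_swap (F \<otimes>\<^bsub>Aut\<^esub> G) = conj_swap F \<otimes>\<^bsub>Aut\<^esub> conj_swap G" for F G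
    by (simp add: Aut_def)
qed

lemma conj_swap_shears:
  "conj_swap (shearK m a) = shearH m a" "conj_swap (shearH m a) = shearK m a"
  by (auto simp: conj_swap_def comp_map_def intro: eval2_eqI)

lemma conj_swap_image: "conj_swap ` Kgrp m = Hgrp m" "conj_swap ` Hgrp m = Kgrp m"
  using conj_swap_shears by (auto simp: Kgrp_def Hgrp_def image_iff) metis+

text \<open>Conjugation by \<open>swap\<close> is a two-sided translation, so the preimage of the
  closure on the right is closed; it contains \<open>A\<close>.\<close>

lemma conj_swap_closure:
  assumes A: "A \<subseteq> carrier Aut" and F: "F \<in> ind_topology closure_of A"
  shows "conj_swap F \<in> ind_topology closure_of (conj_swap ` A)"
proof -
  let ?C = "ind_topology closure_of (conj_swap ` A)"
  have "conj_swap ` A \<subseteq> carrier Aut" using A hom_carrier[OF conj_swap_hom] by blast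
  then have "conj_swap ` A \<subseteq> ?C"
    using closure_of_subset[of _ ind_topology] by (simp add: topspace_ind_topology)
  then have "ind_topology closure_of A \<subseteq> {F \<in> carrier Aut. conj_swap F \<in> ?C}"
    unfolding conj_swap_def
    by (intro closure_of_minimal closedin_translates swap_carrier)
      (use A in \<open>auto simp: conj_swap_def\<close>)
  then show ?thesis using F by blast
qed

theorem theorem20:
  fixes d :: nat
  assumes "d \<ge> 2"
  shows "Kgrp d \<subseteq> ind_topology closure_of (generate Aut (Kgrp 2 \<union> Hgrp 1))
       \<and> Hgrp d \<subseteq> ind_topology closure_of (generate Aut (Hgrp 2 \<union> Kgrp 1))"
proof
  show K: "Kgrp d \<subseteq> ind_topology closure_of (generate Aut (Kgrp 2 \<union> Hgrp 1))"
    by (rule Kgrp_subset_closure[OF assms])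
  interpret group_hom Aut Aut conj_swap
    using group_Aut conj_swap_hom by (simp add: group_hom_def group_hom_axioms_def)
  let ?S = "Kgrp 2 \<union> Hgrp 1"
  have S: "?S \<subseteq> carrier Aut"
    using subgroup.subset[OF subgroup_Kgrp] subgroup.subset[OF subgroup_Hgrp] by auto
  \<comment> \<open>A homomorphism maps the generated subgroup onto the one generated by the images,
    and \<open>conj_swap\<close> exchanges the two families of shears.\<close>
  have "conj_swap ` generate Aut ?S = generate Aut (Hgrp 2 \<union> Kgrp 1)"
    using generate_img[OF S] by (simp add: image_Un conj_swap_image)
  then have "conj_swap ` Kgrp d \<subseteq> ind_topology closure_of (generate Aut (Hgrp 2 \<union> Kgrp 1))"
    using K conj_swap_closure[OF G.generate_incl[OF S]] by auto
  then show "Hgrp d \<subseteq> ind_topology closure_of (generate Aut (Hgrp 2 \<union> Kgrp 1))"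
    by (simp add: conj_swap_image)
qed

end
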